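(* For every $p\in[1,\infty]$ and every $n\in\mathbb{N}$, there is a set $A$ of $2n$ points in $\ell_p$ with the following property: every embedding of $A$ into $\ell_\infty$ with distortion smaller than $2^{\max\{\frac12,1-\frac1p\}}$ has dimension at least $n$.
   Context: An embedding $f:A\to\ell_\infty^D$ has distortion $t$ if $\|x-y\|_p\le\|f(x)-f(y)\|_\infty\le t\|x-y\|_p$ for all $x,y\in A$, up to rescaling. Its dimension is $D$. *)

theory Defs
  imports "HOL-Analysis.Analysis" "HOL-Library.Extended_Real"
begin

definition lp_space :: "ereal \<Rightarrow> (nat \<Rightarrow> real) set" where
  "lp_space p =
    (if p = \<infinity> then {x. bounded (range x)}
     else {x. summable (\<lambda>i. \<bar>x i\<bar> powr real_of_ereal p)})"

definition lp_norm :: "ereal \<Rightarrow> (nat \<Rightarrow> real) \<Rightarrow> real" where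
  "lp_norm p x =
    (if p = \<infinity> then (SUP i. \<bar>x i\<bar>)
     else (\<Sum>i. \<bar>x i\<bar> powr real_of_ereal p) powr (1 / real_of_ereal p))"

definition lp_dist :: "ereal \<Rightarrow> (nat \<Rightarrow> real) \<Rightarrow> (nat \<Rightarrow> real) \<Rightarrow> real" where
  "lp_dist p x y = lp_norm p (\<lambda>i. x i - y i)"

text \<open>
  The \<open>D\<close>-dimensional space $\ell_\infty^D$, realised as the sequences supported on the first
  \<open>D\<close> coordinates. Its norm is the restriction of \<open>lp_norm \<infinity>\<close>, which also gives the
  correct value in the degenerate case \<open>D = 0\<close>.
\<close>

definition linf_fin :: "nat \<Rightarrow> (nat \<Rightarrow> real) set" where
  "linf_fin D = {y. \<forall>i\<ge>D. y i = 0}"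

text \<open>
  The factor \<open>c\<close> implements ``up to rescaling'': the bounds are required of the map
  \<open>\<lambda>x. c \<cdot> f x\<close> for some positive \<open>c\<close>.
\<close>

definition linf_embedding_with_distortion ::
    "ereal \<Rightarrow> (nat \<Rightarrow> real) set \<Rightarrow> nat \<Rightarrow> ((nat \<Rightarrow> real) \<Rightarrow> (nat \<Rightarrow> real)) \<Rightarrow> real \<Rightarrow> bool" where
  "linf_embedding_with_distortion p A D f t \<longleftrightarrow>
     f \<in> A \<rightarrow> linf_fin D \<and>
     (\<exists>c>0. \<forall>x\<in>A. \<forall>y\<in>A.
        lp_dist p x y \<le> c * lp_dist \<infinity> (f x) (f y) \<and>
        c * lp_dist \<infinity> (f x) (f y) \<le> t * lp_dist p x y)"

end

theory Submission
  imports Defs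
begin

text \<open>
  Take \<open>n\<close> pairs of points such that the two points of each pair are at distance \<open>a\<close>, while points
  of different pairs are at distance \<open>b\<close>. Under an embedding into $\ell_\infty^D$, each pair is
  separated by at least \<open>a\<close> in some coordinate. If two pairs shared this coordinate, then two intervals
  of length at least \<open>a\<close> on the line would have all their cross distances at most \<open>t b\<close>, which is
  impossible for \<open>t b < a\<close>. Hence \<open>n \<le> D\<close> as soon as \<open>t < a / b\<close>. The pairs $\pm e_i$ give
  $a / b = 2^{1 - 1/p}$, which is used for $p \ge 2$. For $p < 2$ the pairs $\pm r_i$ of Rademacher
  vectors on the cube $\{-1,1\}^n$ give $a / b = 2^{1/p} \ge 2^{1/2}$.
\<close>

section \<open>Finitely supported sequences and the sup distance on
  \<open>linf_fin D\<close>\<close>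

lemma lp_dist_self [simp]: "lp_dist p x x = 0"
  by (simp add: lp_dist_def lp_norm_def)

lemma lp_dist_finite_support:
  assumes "finite K" "r > 0" "\<And>k. k \<notin> K \<Longrightarrow> x k = y k"
  shows "lp_dist (ereal r) x y = (\<Sum>k\<in>K. \<bar>x k - y k\<bar> powr r) powr (1 / r)"
proof -
  have "(\<Sum>k. \<bar>x k - y k\<bar> powr r) = (\<Sum>k\<in>K. \<bar>x k - y k\<bar> powr r)"
    using assms by (intro suminf_finite) auto
  then show ?thesis
    by (simp add: lp_dist_def lp_norm_def)
qed

lemma lp_space_finite_support:
  assumes "finite K" "\<And>k. k \<notin> K \<Longrightarrow> x k = 0"
  shows "x \<in> lp_space p"
proof (cases "p = \<infinity>")
  case True
  have "range x \<subseteq> insert 0 (x ` K)"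
    using assms(2) by auto
  then have "finite (range x)"
    using assms(1) by (meson finite.insertI finite_imageI finite_subset)
  then show ?thesis
    using True by (simp add: lp_space_def finite_imp_bounded)
next
  case False
  \<comment> \<open>Terms outside \<open>K\<close> vanish whatever the exponent, since
    \<open>0 powr a = 0\<close> even for \<open>a = 0\<close>.\<close>
  have "summable (\<lambda>i. \<bar>x i\<bar> powr real_of_ereal p)"
    using assms by (intro summable_finite[of K]) auto
  then show ?thesis
    using False by (simp add: lp_space_def)
qed

text \<open>With finitely many values, the supremum defining the distance is over a bounded set and
  is a maximum.\<close>

lemma finite_range_linf_fin_diff:
  assumes "x \<in> linf_fin D" "y \<in> linf_fin D"
  shows "finite (range (\<lambda>k. \<bar>x k - y k\<bar>))"
proof (rule finite_subset)
  show "range (\<lambda>k. \<bar>x k - y k\<bar>) \<subseteq> insert 0 ((\<lambda>k. \<bar>x k - y k\<bar>) ` {..<D})"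
  proof clarsimp
    fix k assume "\<bar>x k - y k\<bar> \<notin> (\<lambda>k. \<bar>x k - y k\<bar>) ` {..<D}"
    then have "D \<le> k"
      by (meson imageI lessThan_iff not_le)
    with assms show "x k = y k"
      by (simp add: linf_fin_def)
  qed
qed simp

lemma linf_dist_ge_coordinate:
  assumes "x \<in> linf_fin D" "y \<in> linf_fin D"
  shows "\<bar>x k - y k\<bar> \<le> lp_dist \<infinity> x y"
  using cSUP_upper[of k UNIV "\<lambda>k. \<bar>x k - y k\<bar>"] finite_range_linf_fin_diff[OF assms]
  by (simp add: lp_dist_def lp_norm_def)

text \<open>Coordinates from \<open>D\<close> on contribute only 0, so a positive distance must be
  attained below \<open>D\<close>; in particular this rules out \<open>D = 0\<close>.\<close>

lemma linf_dist_attained: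
  assumes "x \<in> linf_fin D" "y \<in> linf_fin D" "0 < lp_dist \<infinity> x y"
  obtains k where "k < D" "lp_dist \<infinity> x y = \<bar>x k - y k\<bar>"
proof -
  have "Max (range (\<lambda>k. \<bar>x k - y k\<bar>)) \<in> range (\<lambda>k. \<bar>x k - y k\<bar>)"
    using finite_range_linf_fin_diff[OF assms(1,2)] by (intro Max_in) auto
  moreover have "lp_dist \<infinity> x y = Max (range (\<lambda>k. \<bar>x k - y k\<bar>))"
    using finite_range_linf_fin_diff[OF assms(1,2)]
    by (simp add: lp_dist_def lp_norm_def cSup_eq_Max)
  ultimately obtain k where k: "lp_dist \<infinity> x y = \<bar>x k - y k\<bar>"
    by auto
  moreover have "k < D"
  proof (rule ccontr)
    assume "\<not> k < D"
    with assms(1,2) have "x k = y k"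
      by (simp add: linf_fin_def)
    with k assms(3) show False
      by simp
  qed
  ultimately show ?thesis
    using that by blast
qed

section \<open>From pairs of points to a dimension bound\<close>

text \<open>The rescaling factor \<open>c\<close> is absorbed into the coordinates of
  \<open>f\<close>. Choosing for each pair a coordinate that separates it by at least
  \<open>a\<close> then gives an injection \<open>J\<close> of the \<open>n\<close> pairs into the
  \<open>D\<close> coordinates.\<close>

lemma paired_points_dimension_bound:
  fixes g :: "nat \<Rightarrow> bool \<Rightarrow> nat \<Rightarrow> real"
  assumes mem: "\<And>i s. i < n \<Longrightarrow> g i s \<in> A"
    and same: "\<And>i. i < n \<Longrightarrow> lp_dist p (g i True) (g i False) = a"
    and cross: "\<And>i j s u. i < n \<Longrightarrow> j < n \<Longrightarrow> i \<noteq> j \<Longrightarrow> lp_dist p (g i s) (g j u) = b"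
    and "0 < a" "t * b < a"
    and emb: "linf_embedding_with_distortion p A D f t"
  shows "n \<le> D"
proof -
  from emb obtain c where fin: "\<And>x. x \<in> A \<Longrightarrow> f x \<in> linf_fin D" and "c > 0"
    and lower: "\<And>x y. x \<in> A \<Longrightarrow> y \<in> A \<Longrightarrow> lp_dist p x y \<le> c * lp_dist \<infinity> (f x) (f y)"
    and upper: "\<And>x y. x \<in> A \<Longrightarrow> y \<in> A \<Longrightarrow> c * lp_dist \<infinity> (f x) (f y) \<le> t * lp_dist p x y"
    unfolding linf_embedding_with_distortion_def by blast
  have "\<exists>k<D. a \<le> \<bar>c * f (g i True) k - c * f (g i False) k\<bar>" if "i < n" for i
  proof -
    have le: "a \<le> c * lp_dist \<infinity> (f (g i True)) (f (g i False))"
      using lower[OF mem mem, of i i True False] same that by simp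
    with \<open>0 < a\<close> \<open>c > 0\<close> have "0 < lp_dist \<infinity> (f (g i True)) (f (g i False))"
      by (smt (verit) zero_less_mult_pos)
    with fin mem that obtain k where "k < D"
      "lp_dist \<infinity> (f (g i True)) (f (g i False)) = \<bar>f (g i True) k - f (g i False) k\<bar>"
      by (metis linf_dist_attained)
    with le \<open>c > 0\<close> show ?thesis
      by (auto simp: abs_mult simp flip: right_diff_distrib)
  qed
  then obtain J where J: "\<And>i. i < n \<Longrightarrow> J i < D"
    "\<And>i. i < n \<Longrightarrow> a \<le> \<bar>c * f (g i True) (J i) - c * f (g i False) (J i)\<bar>"
    by metis
  have near: "\<bar>c * f (g i s) k - c * f (g j u) k\<bar> < a"
    if "i < n" "j < n" "i \<noteq> j" for i j s u k
  proof -
    have "\<bar>c * f (g i s) k - c * f (g j u) k\<bar> = c * \<bar>f (g i s) k - f (g j u) k\<bar>"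
      using \<open>c > 0\<close> by (simp add: abs_mult flip: right_diff_distrib)
    also have "\<dots> \<le> c * lp_dist \<infinity> (f (g i s)) (f (g j u))"
      using \<open>c > 0\<close> fin mem that by (intro mult_left_mono linf_dist_ge_coordinate) auto
    also have "\<dots> \<le> t * b"
      using upper[OF mem mem, of i j s u] cross that by simp
    finally show ?thesis
      using \<open>t * b < a\<close> by simp
  qed
  have "inj_on J {..<n}"
  proof (rule inj_onI, rule ccontr)
    fix i j assume ij: "i \<in> {..<n}" "j \<in> {..<n}" "J i = J j" "i \<noteq> j"
    \<comment> \<open>Let x < x' be the values of pair \<open>i\<close> and y < y' those of pair
      \<open>j\<close> at the common coordinate. Then (x' - y) + (y' - x) = (x' - x) + (y' - y) is
      at least \<open>2 * a\<close>, whereas each bracket on the left is below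
      \<open>a\<close>.\<close>
    then show False
      using J(2)[of i] J(2)[of j] near[of i j True "J j" True] near[of i j True "J j" False]
        near[of i j False "J j" True] near[of i j False "J j" False]
      by auto
  qed
  then have "card {..<n} \<le> card {..<D}"
    using J(1) by (intro card_inj_on_le) auto
  then show ?thesis
    by simp
qed

text \<open>Equal points have distance 0, so the positive distances keep all \<open>2 * n\<close>
  labels apart.\<close>

lemma card_paired_points:
  fixes g :: "nat \<Rightarrow> bool \<Rightarrow> nat \<Rightarrow> real"
  assumes same: "\<And>i. i < n \<Longrightarrow> lp_dist p (g i True) (g i False) > 0"
    and cross: "\<And>i j s u. i < n \<Longrightarrow> j < n \<Longrightarrow> i \<noteq> j \<Longrightarrow> lp_dist p (g i s) (g j u) > 0"
  shows "card ((\<lambda>(i, s). g i s) ` ({..<n} \<times> UNIV)) = 2 * n"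
proof -
  have "inj_on (\<lambda>(i, s). g i s) ({..<n} \<times> UNIV)"
  proof (rule inj_onI, clarsimp)
    fix i j s u assume ij: "i < n" "j < n" "g i s = g j u"
    then have "i = j"
      using cross[of i j s u] by auto
    moreover have "s = u"
      using ij same[of i] \<open>i = j\<close> by (cases s; cases u) auto
    ultimately show "i = j \<and> s = u"
      by simp
  qed
  then show ?thesis
    by (simp add: card_image card_cartesian_product)
qed

text \<open>The non-strict bound \<open>T * b \<le> a\<close> lets the threshold equal the ratio a /
  b: from \<open>t < T\<close> and \<open>0 < b\<close> follows \<open>t * b < a\<close>.\<close>

lemma exists_set_of_large_linf_dimension:
  fixes g :: "nat \<Rightarrow> bool \<Rightarrow> nat \<Rightarrow> real"
  assumes "\<And>i s. i < n \<Longrightarrow> g i s \<in> lp_space p"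
    and same: "\<And>i. i < n \<Longrightarrow> lp_dist p (g i True) (g i False) = a"
    and cross: "\<And>i j s u. i < n \<Longrightarrow> j < n \<Longrightarrow> i \<noteq> j \<Longrightarrow> lp_dist p (g i s) (g j u) = b"
    and "0 < b" "0 < T" "T * b \<le> a"
  shows "\<exists>A. A \<subseteq> lp_space p \<and> finite A \<and> card A = 2 * n \<and>
           (\<forall>D f t. linf_embedding_with_distortion p A D f t \<and> t < T \<longrightarrow> n \<le> D)"
proof (intro exI conjI allI impI; (elim conjE)?)
  let ?A = "(\<lambda>(i, s). g i s) ` ({..<n} \<times> UNIV)"
  have "0 < a"
    using assms(4-6) by (smt (verit) mult_pos_pos)
  show "?A \<subseteq> lp_space p" "finite ?A"
    using assms(1) by auto
  show "card ?A = 2 * n"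
    using same cross \<open>0 < a\<close> \<open>0 < b\<close> by (intro card_paired_points[of n p g]) auto
  fix D f t
  assume "linf_embedding_with_distortion p ?A D f t" "t < T"
  moreover have "t * b < a"
    using \<open>t < T\<close> \<open>0 < b\<close> \<open>T * b \<le> a\<close> by (smt (verit) mult_strict_right_mono)
  ultimately show "n \<le> D"
    using same cross \<open>0 < a\<close> by (intro paired_points_dimension_bound[of n g ?A p a b t D f]) auto
qed

section \<open>Signed unit vectors\<close>

definition signed_unit :: "nat \<Rightarrow> bool \<Rightarrow> nat \<Rightarrow> real" where
  "signed_unit i s k = (if k = i then if s then 1 else - 1 else 0)"

lemma signed_unit_in_lp_space: "signed_unit i s \<in> lp_space p"
  by (rule lp_space_finite_support[of "{i}"]) (auto simp: signed_unit_def)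

lemma linf_dist_signed_unit_antipodal:
  "lp_dist \<infinity> (signed_unit i True) (signed_unit i False) = 2"
proof -
  have "(SUP k. \<bar>signed_unit i True k - signed_unit i False k\<bar>) = 2"
    by (intro cSup_eq_maximum) (auto simp: signed_unit_def image_iff intro: exI[of _ i])
  then show ?thesis
    by (simp add: lp_dist_def lp_norm_def)
qed

lemma linf_dist_signed_unit:
  assumes "i \<noteq> j"
  shows "lp_dist \<infinity> (signed_unit i s) (signed_unit j u) = 1"
proof -
  have "(SUP k. \<bar>signed_unit i s k - signed_unit j u k\<bar>) = 1"
    using assms by (intro cSup_eq_maximum) (auto simp: signed_unit_def image_iff intro: exI[of _ i])
  then show ?thesis
    by (simp add: lp_dist_def lp_norm_def)
qed

lemma lp_dist_signed_unit_antipodal: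
  assumes "r > 0"
  shows "lp_dist (ereal r) (signed_unit i True) (signed_unit i False) = 2"
  using assms
  by (subst lp_dist_finite_support[of "{i}"]) (auto simp: signed_unit_def powr_powr)

text \<open>The supports are disjoint, so whatever the signs, the difference has exactly two nonzero
  entries, each of absolute value 1.\<close>

lemma lp_dist_signed_unit:
  assumes "r > 0" "i \<noteq> j"
  shows "lp_dist (ereal r) (signed_unit i s) (signed_unit j u) = 2 powr (1 / r)"
  using assms
  by (subst lp_dist_finite_support[of "{i, j}"]) (auto simp: signed_unit_def)

section \<open>Rademacher vectors on the cube\<close>

text \<open>
  The cube is modelled as \<open>Pow {..<n}\<close>, enumerated by an arbitrary bijection
  \<open>\<phi>\<close> from \<open>{..<2 ^ n}\<close>.
\<close>

definition rademacher :: "(nat \<Rightarrow> nat set) \<Rightarrow> nat \<Rightarrow> nat \<Rightarrow> bool \<Rightarrow> nat \<Rightarrow> real" where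
  "rademacher \<phi> n i s k = (if k < 2 ^ n then if (i \<in> \<phi> k) = s then 1 else - 1 else 0)"

lemma rademacher_in_lp_space: "rademacher \<phi> n i s \<in> lp_space p"
  by (rule lp_space_finite_support[of "{..<2 ^ n}"]) (auto simp: rademacher_def)

lemma lp_dist_rademacher_antipodal:
  assumes "r > 0"
  shows "lp_dist (ereal r) (rademacher \<phi> n i True) (rademacher \<phi> n i False)
    = (2 ^ n * 2 powr r) powr (1 / r)"
proof -
  have "(\<Sum>k<2 ^ n. \<bar>rademacher \<phi> n i True k - rademacher \<phi> n i False k\<bar> powr r)
      = (\<Sum>k<(2::nat) ^ n. 2 powr r)"
    by (intro sum.cong) (auto simp: rademacher_def)
  then show ?thesis
    using assms
    by (subst lp_dist_finite_support[of "{..<2 ^ n}"]) (auto simp: rademacher_def)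
qed

text \<open>Two signed Rademacher vectors with different indices differ on exactly half of the cube,
  and there by 2. Flipping membership of \<open>i\<close> exchanges the points of agreement with
  those of disagreement.\<close>

lemma lp_dist_rademacher:
  assumes "r > 0" "bij_betw \<phi> {..<2 ^ n} (Pow {..<n})" "i < n" "i \<noteq> j"
  shows "lp_dist (ereal r) (rademacher \<phi> n i s) (rademacher \<phi> n j u)
    = (2 ^ n * 2 powr r / 2) powr (1 / r)"
proof -
  \<comment> \<open>\<open>E S\<close> is the contribution of the cube point \<open>S\<close> to the
    sum of \<open>r\<close>-th powers.\<close>
  define E where "E S = (if ((i \<in> S) = s) = ((j \<in> S) = u) then 0 else 2 powr r)" for S
  define flip where "flip S = (if i \<in> S then S - {i} else insert i S)" for S
  have "(\<Sum>k<2 ^ n. \<bar>rademacher \<phi> n i s k - rademacher \<phi> n j u k\<bar> powr r)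
      = (\<Sum>k<2 ^ n. E (\<phi> k))"
    by (intro sum.cong) (auto simp: rademacher_def E_def)
  also have "\<dots> = (\<Sum>S\<in>Pow {..<n}. E S)"
    by (rule sum.reindex_bij_betw[OF assms(2)])
  also have "\<dots> = 2 ^ n * 2 powr r / 2"
  proof -
    have "(\<Sum>S\<in>Pow {..<n}. E S) = (\<Sum>S\<in>Pow {..<n}. E (flip S))"
      by (rule sum.reindex_bij_witness[of _ flip flip])
        (use \<open>i < n\<close> in \<open>auto simp: flip_def insert_absorb split: if_splits\<close>)
    then have "2 * (\<Sum>S\<in>Pow {..<n}. E S) = (\<Sum>S\<in>Pow {..<n}. E S + E (flip S))"
      by (simp add: sum.distrib)
    \<comment> \<open>As \<open>i \<noteq> j\<close>, \<open>flip\<close> leaves the sign of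
      \<open>j\<close> alone, so exactly one of \<open>S\<close> and \<open>flip S\<close>
      contributes.\<close>
    also have "\<dots> = (\<Sum>S\<in>Pow {..<n}. 2 powr r)"
      using \<open>i \<noteq> j\<close> by (intro sum.cong) (auto simp: E_def flip_def)
    also have "\<dots> = 2 ^ n * 2 powr r"
      by (simp add: card_Pow)
    finally show ?thesis
      by simp
  qed
  finally have sum: "(\<Sum>k<2 ^ n. \<bar>rademacher \<phi> n i s k - rademacher \<phi> n j u k\<bar> powr r)
      = 2 ^ n * 2 powr r / 2" .
  have "lp_dist (ereal r) (rademacher \<phi> n i s) (rademacher \<phi> n j u)
      = (\<Sum>k<2 ^ n. \<bar>rademacher \<phi> n i s k - rademacher \<phi> n j u k\<bar> powr r) powr (1 / r)"
    using \<open>r > 0\<close> by (intro lp_dist_finite_support) (auto simp: rademacher_def)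
  then show ?thesis
    unfolding sum .
qed

section \<open>Choice of the configuration according to the exponent\<close>

theorem theorem3p2:
  fixes p :: ereal and n :: nat
  assumes "1 \<le> p"
  shows "\<exists>A. A \<subseteq> lp_space p \<and> finite A \<and> card A = 2 * n \<and>
           (\<forall>D f t. linf_embedding_with_distortion p A D f t \<and>
                    t < 2 powr (max (1/2) (1 - real_of_ereal (1 / p)))
                \<longrightarrow> n \<le> D)"
proof (cases p)
  case PInf
  \<comment> \<open>Here \<open>1 / p\<close> evaluates to 0, so the threshold is 2, the ratio of
    \<open>a\<close> to \<open>b\<close>.\<close>
  show ?thesis
    unfolding PInf
    by (rule exists_set_of_large_linf_dimension[where g = signed_unit and a = 2 and b = 1])
      (auto simp: signed_unit_in_lp_space linf_dist_signed_unit_antipodal linf_dist_signed_unit)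
next
  case MInf
  with assms show ?thesis
    by simp
next
  case (real r)
  then have "1 \<le> r"
    using assms by (simp add: one_ereal_def)
  then have recip: "real_of_ereal (1 / ereal r) = 1 / r"
    by (simp add: one_ereal_def)
  show ?thesis
  proof (cases "2 \<le> r")
    case True
    then have "max (1/2) (1 - 1 / r) = 1 - 1 / r"
      by (simp add: field_simps)
    \<comment> \<open>The threshold equals the ratio exactly: 2 powr (1 - 1 / r) times 2 powr (1 /
      r) is 2.\<close>
    then show ?thesis
      unfolding real recip using True
      by (intro exists_set_of_large_linf_dimension[where g = signed_unit and a = 2 and b = "2 powr (1 / r)"])
        (auto simp: signed_unit_in_lp_space lp_dist_signed_unit_antipodal lp_dist_signed_unit
          simp flip: powr_add)
  next
    case False
    then have max: "max (1/2) (1 - 1 / r) = 1 / 2"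
      using \<open>1 \<le> r\<close> by (simp add: field_simps)
    obtain \<phi> :: "nat \<Rightarrow> nat set" where \<phi>: "bij_betw \<phi> {..<2 ^ n} (Pow {..<n})"
      using ex_bij_betw_nat_finite[of "Pow {..<n}"] by (auto simp: card_Pow atLeast0LessThan)
    let ?b = "(2 ^ n * 2 powr r / 2) powr (1 / r)"
    \<comment> \<open>Since \<open>r < 2\<close>, the exponent 1/2 is below 1 / r, and multiplying
      \<open>?b\<close> by \<open>2 powr (1 / r)\<close> gives the antipodal distance.\<close>
    have "2 powr (1 / 2) * ?b \<le> 2 powr (1 / r) * ?b"
      using False \<open>1 \<le> r\<close> by (intro mult_right_mono powr_mono) (auto simp: field_simps)
    also have "\<dots> = (2 * (2 ^ n * 2 powr r / 2)) powr (1 / r)"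
      by (subst powr_mult) auto
    finally have "2 powr (1 / 2) * ?b \<le> (2 ^ n * 2 powr r) powr (1 / r)"
      by simp
    then show ?thesis
      unfolding real recip max using \<open>1 \<le> r\<close> \<phi>
      by (intro exists_set_of_large_linf_dimension[where g = "rademacher \<phi> n"
            and a = "(2 ^ n * 2 powr r) powr (1 / r)" and b = ?b])
        (auto simp: rademacher_in_lp_space lp_dist_rademacher_antipodal lp_dist_rademacher)
  qed
qed

end
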